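(* Let $X$ and $Y$ be Banach spaces such that, for every $n\in\mathbb{N}$, there is no linear embedding of $c_0(X)$ into $Y^n$. Then $\ell_\infty(Y)$ has no complemented subspace isomorphic to $c_0(X)$.
   Context: $\mathbb{N}=\{1,2,\ldots\}$. For a Banach space $X$, $\ell_\infty(X)$ is the Banach space of bounded sequences in $X$ and $c_0(X)$ is the Banach space of sequences in $X$ converging to $0$ in norm, both with the supremum norm; $Y^n$ is the direct sum of $n$ copies of $Y$. A linear embedding of $X$ into $Y$ is a bounded linear operator $T:X\to Y$ for which there is $C>0$ with $C\|u\|\leq\|T(u)\|$ for all $u\in X$. Isomorphic means linearly homeomorphic. A complemented subspace is the image of a bounded linear projection. *)

theory Defs
  imports "HOL-Analysis.Analysis"
begin

text \<open>
  Banach spaces over the real or the complex field. The library class \<open>banach\<close> only provides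
  real scalars, so the scalar multiplication \<open>smul\<close> over a field \<open>'k\<close> is a parameter that has to
  extend the built-in real one. By the Gelfand--Mazur theorem a type of class \<open>real_normed_field\<close>
  is isometrically isomorphic to the reals or to the complex numbers, so these are exactly the two
  usual scalar fields.
\<close>

locale banach_space_over = vector_space smul
  for smul :: "'k::real_normed_field \<Rightarrow> 'a::banach \<Rightarrow> 'a" +
  assumes norm_scale: "norm (smul c x) = norm c * norm x"
    and scale_of_real: "smul (of_real r) x = r *\<^sub>R x"

lemma banach_space_over_scaleR: "banach_space_over (scaleR :: real \<Rightarrow> 'a::banach \<Rightarrow> 'a)"
  by unfold_locales (simp_all add: algebra_simps)

lemma banach_space_over_complex: "banach_space_over ((*) :: complex \<Rightarrow> complex \<Rightarrow> complex)"
  by unfold_locales (simp_all add: algebra_simps norm_mult scaleR_conv_of_real)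

text \<open>
  Since every function on \<open>nat\<close> is continuous, the type \<open>nat \<Rightarrow>\<^sub>C 'a\<close> of bounded continuous
  functions with the supremum norm is the space of bounded sequences in \<open>'a\<close>.
\<close>

type_synonym 'a linf = "nat \<Rightarrow>\<^sub>C 'a"

text \<open>The library proves completeness only for metric domains, and \<open>nat\<close> has no metric there.\<close>

instance bcontfun :: (topological_space, complete_space) complete_space
proof
  fix f :: "nat \<Rightarrow> ('a, 'b) bcontfun"
  assume "Cauchy f"
  then obtain g where "uniform_limit UNIV f g sequentially"
    using uniformly_convergent_eq_cauchy[of "\<lambda>_. True" f]
    unfolding Cauchy_def uniform_limit_sequentially_iff
    by (metis dist_fun_lt_imp_dist_val_lt)
  from uniform_limit_bcontfunE[OF this sequentially_bot]
  obtain l where "f \<longlonglongrightarrow> l" by metis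
  then show "convergent f"
    by (intro convergentI)
qed

instance bcontfun :: (topological_space, banach) banach ..

lemma range_apply_linf: "range (apply_bcontfun :: 'a::metric_space linf \<Rightarrow> _) = {f. bounded (range f)}"
proof -
  have "(bcontfun :: (nat \<Rightarrow> 'a) set) = {f. bounded (range f)}"
    by (auto simp: bcontfun_def)
  then show ?thesis
    using type_definition.Rep_range[OF type_definition_bcontfun] by blast
qed

lemma norm_linf: "norm (f :: 'a::real_normed_vector linf) = (SUP i. norm (apply_bcontfun f i))"
  by (simp add: norm_bcontfun_def dist_bcontfun_def)

definition linf_scale :: "('k \<Rightarrow> 'a \<Rightarrow> 'a) \<Rightarrow> 'k \<Rightarrow> 'a::metric_space linf \<Rightarrow> 'a linf" where
  "linf_scale smul c f = Bcontfun (\<lambda>i. smul c (apply_bcontfun f i))"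

lemma (in banach_space_over) apply_linf_scale:
  "apply_bcontfun (linf_scale smul c f) i = smul c (apply_bcontfun f i)"
proof -
  have "norm (smul c (apply_bcontfun f j)) \<le> norm c * norm f" for j
    by (simp add: norm_scale mult_left_mono norm_bounded)
  then have "(\<lambda>j. smul c (apply_bcontfun f j)) \<in> bcontfun"
    by (intro bcontfun_normI) simp_all
  then show ?thesis
    by (simp add: linf_scale_def Bcontfun_inverse)
qed

lemma (in banach_space_over) banach_space_over_linf: "banach_space_over (linf_scale smul)"
proof
  fix c :: 'k and f :: "'a linf"
  show "norm (linf_scale smul c f) = norm c * norm f"
  proof (rule antisym)
    show *: "norm (linf_scale smul c f) \<le> norm c * norm f" for c and f :: "'a linf"
      by (rule norm_bound) (simp add: apply_linf_scale norm_scale mult_left_mono norm_bounded)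
    show "norm c * norm f \<le> norm (linf_scale smul c f)"
    proof (cases "c = 0")
      case False
      have "linf_scale smul (inverse c) (linf_scale smul c f) = f"
        using False by (intro bcontfun_eqI) (simp add: apply_linf_scale)
      then have "norm f \<le> inverse (norm c) * norm (linf_scale smul c f)"
        using *[of "inverse c" "linf_scale smul c f"] by (simp add: norm_inverse)
      then show ?thesis
        using False by (simp add: field_simps)
    qed simp
  qed
qed (auto intro!: bcontfun_eqI
    simp: apply_linf_scale scale_right_distrib scale_left_distrib scale_of_real)

definition c0 :: "'a::real_normed_vector linf set" where
  "c0 = {f. apply_bcontfun f \<longlonglongrightarrow> 0}"

text \<open>
  The direct sum of \<open>n\<close> copies of a space, realised as the sequences that vanish from index \<open>n\<close> on.
  The norm is the maximum of the norms of the \<open>n\<close> components.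
\<close>

definition npower :: "nat \<Rightarrow> 'a::real_normed_vector linf set" where
  "npower n = {f. \<forall>i\<ge>n. apply_bcontfun f i = 0}"

text \<open>
  In the following definitions \<open>s1\<close> and \<open>s2\<close> are the scalar multiplications of the two types, and
  \<open>S\<close> and \<open>T\<close> are linear subspaces considered as normed spaces in their own right.
\<close>

definition linear_map_on ::
    "('k \<Rightarrow> 'a \<Rightarrow> 'a) \<Rightarrow> ('k \<Rightarrow> 'b \<Rightarrow> 'b) \<Rightarrow> 'a::real_normed_vector set \<Rightarrow>
      ('a \<Rightarrow> 'b::real_normed_vector) \<Rightarrow> bool" where
  "linear_map_on s1 s2 S f \<longleftrightarrow>
    (\<forall>x\<in>S. \<forall>y\<in>S. f (x + y) = f x + f y) \<and> (\<forall>c. \<forall>x\<in>S. f (s1 c x) = s2 c (f x))"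

definition bounded_linear_map_on ::
    "('k \<Rightarrow> 'a \<Rightarrow> 'a) \<Rightarrow> ('k \<Rightarrow> 'b \<Rightarrow> 'b) \<Rightarrow> 'a::real_normed_vector set \<Rightarrow>
      ('a \<Rightarrow> 'b::real_normed_vector) \<Rightarrow> bool" where
  "bounded_linear_map_on s1 s2 S f \<longleftrightarrow>
    linear_map_on s1 s2 S f \<and> (\<exists>B. \<forall>x\<in>S. norm (f x) \<le> B * norm x)"

definition linear_embedding ::
    "('k \<Rightarrow> 'a \<Rightarrow> 'a) \<Rightarrow> ('k \<Rightarrow> 'b \<Rightarrow> 'b) \<Rightarrow> 'a::real_normed_vector set \<Rightarrow>
      'b::real_normed_vector set \<Rightarrow> ('a \<Rightarrow> 'b) \<Rightarrow> bool" where
  "linear_embedding s1 s2 S T f \<longleftrightarrow>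
    bounded_linear_map_on s1 s2 S f \<and> f ` S \<subseteq> T \<and> (\<exists>C>0. \<forall>x\<in>S. C * norm x \<le> norm (f x))"

definition linearly_homeomorphic ::
    "('k \<Rightarrow> 'a \<Rightarrow> 'a) \<Rightarrow> ('k \<Rightarrow> 'b \<Rightarrow> 'b) \<Rightarrow> 'a::real_normed_vector set \<Rightarrow>
      'b::real_normed_vector set \<Rightarrow> bool" where
  "linearly_homeomorphic s1 s2 S T \<longleftrightarrow>
    (\<exists>f g. linear_map_on s1 s2 S f \<and> homeomorphism S T f g)"

definition complemented_subspace ::
    "('k \<Rightarrow> 'a \<Rightarrow> 'a) \<Rightarrow> 'a::real_normed_vector set \<Rightarrow> bool" where
  "complemented_subspace s Z \<longleftrightarrow>
    (\<exists>P. bounded_linear_map_on s s UNIV P \<and> P \<circ> P = P \<and> range P = Z)"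

end

theory Submission
  imports Defs
begin

text \<open>
  A complemented copy of \<open>c\<^sub>0(X)\<close> in \<open>\<ell>\<^sub>\<infinity>(Y)\<close> amounts to bounded linear maps
  \<open>T : c\<^sub>0(X) \<rightarrow> \<ell>\<^sub>\<infinity>(Y)\<close> and \<open>S : \<ell>\<^sub>\<infinity>(Y) \<rightarrow> c\<^sub>0(X)\<close> with \<open>S T = id\<close>: \<open>T\<close> is the inverse of
  the isomorphism, and \<open>S\<close> is the projection followed by the isomorphism.

  The tail of \<open>c\<^sub>0(X)\<close> beyond any index is again a copy of \<open>c\<^sub>0(X)\<close>. As this space does not embed
  into \<open>Y\<^sup>n\<close>, the first \<open>n\<close> coordinates of \<open>T\<close> are not bounded below on any tail. So there are
  finitely supported vectors \<open>u\<close>, as far out as desired and of norm between \<open>1 / 2\<close> and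
  \<open>1\<close>, for which the first \<open>n\<close> coordinates of \<open>T u\<close> are as small as desired (\<open>hump_exists\<close>).

  A gliding hump picks \<open>u\<^sub>0, u\<^sub>1, \<dots>\<close> with disjoint supports such that, for every set \<open>A\<close> of
  indices, the series of all \<open>T u\<^sub>k\<close> with \<open>k \<in> A\<close> converges coordinatewise to a vector \<open>R A\<close>. Its
  norm is at most \<open>\<parallel>T\<parallel>\<close>, as finite sums of the \<open>u\<^sub>k\<close> have norm at most one. So \<open>T\<close>
  on the closed span of the \<open>u\<^sub>k\<close>, a copy of \<open>c\<^sub>0\<close>, extends to a bounded map on \<open>\<ell>\<^sub>\<infinity>\<close>, and \<open>S\<close> would
  give a bounded projection of \<open>\<ell>\<^sub>\<infinity>\<close> onto \<open>c\<^sub>0\<close>, contrary to the theorem of Phillips and Sobczyk.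

  To see this, choose a coordinate \<open>j\<^sub>k\<close> at which \<open>u\<^sub>k\<close> is large and a real functional \<open>f\<^sub>k\<close> on
  \<open>X\<close> norming \<open>u\<^sub>k(j\<^sub>k)\<close> (\<open>norming_functional_exists\<close>). The set functions
  \<open>\<mu>\<^sub>k A = f\<^sub>k (S (R A) (j\<^sub>k))\<close> are uniformly bounded and additive, they see on singletons only the
  diagonal, and \<open>\<mu>\<^sub>k A\<close> tends to zero for every \<open>A\<close> because \<open>S\<close> takes values in \<open>c\<^sub>0(X)\<close>.
  Whitley's argument with an uncountable almost disjoint family excludes such set functions
  (\<open>no_vanishing_diagonal_set_functions\<close>).
\<close>

section \<open>Norming functionals\<close>

text \<open>
  Asking only for an inequality in the homogeneity makes the property easy to pass to infima. The
  equation follows because \<open>c\<close> may be replaced by its inverse.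
\<close>

definition sublinear :: "('a::real_normed_vector \<Rightarrow> real) \<Rightarrow> bool" where
  "sublinear p \<longleftrightarrow> (\<forall>x y. p (x + y) \<le> p x + p y) \<and> (\<forall>c>0. \<forall>x. p (c *\<^sub>R x) \<le> c * p x)"

lemma sublinear_zero:
  assumes "sublinear p"
  shows "p 0 = 0"
proof -
  have "p (c *\<^sub>R 0) \<le> c * p 0" if "c > 0" for c
    using assms that unfolding sublinear_def by blast
  from this[of 2] this[of "1 / 2"] show ?thesis by simp
qed

lemma sublinear_add: "sublinear p \<Longrightarrow> p (x + y) \<le> p x + p y"
  by (simp add: sublinear_def)

lemma sublinear_scale:
  assumes "sublinear p" and "c \<ge> 0"
  shows "p (c *\<^sub>R x) = c * p x"
proof (cases "c = 0")
  case False
  then have c: "c > 0" using assms by simp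
  have "p (inverse c *\<^sub>R (c *\<^sub>R x)) \<le> inverse c * p (c *\<^sub>R x)"
    using assms c unfolding sublinear_def by (meson positive_imp_inverse_positive)
  then have "c * p x \<le> p (c *\<^sub>R x)"
    using c by (simp add: field_simps)
  then show ?thesis
    using assms c unfolding sublinear_def by (meson antisym)
qed (simp add: sublinear_zero[OF assms(1)])

lemma sublinear_neg: "sublinear p \<Longrightarrow> - p (- x) \<le> p x"
  using sublinear_add[of p x "- x"] sublinear_zero[of p] by simp

text \<open>
  The largest sublinear function below \<open>p\<close> whose value at \<open>- y\<close> is at most \<open>- p y\<close>, that is, which is
  forced to be linear on the line through \<open>y\<close> with the value \<open>p y\<close> at \<open>y\<close>.
\<close>

definition lower_along :: "'a \<Rightarrow> ('a::real_normed_vector \<Rightarrow> real) \<Rightarrow> 'a \<Rightarrow> real" where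
  "lower_along y p x = (INF t\<in>{0..}. p (x + t *\<^sub>R y) - t * p y)"

lemma lower_along_le:
  assumes "sublinear p" and "t \<ge> 0"
  shows "lower_along y p x \<le> p (x + t *\<^sub>R y) - t * p y"
  unfolding lower_along_def
proof (rule cINF_lower)
  have "- p (- x) \<le> p (x + s *\<^sub>R y) - s * p y" if "s \<ge> 0" for s
    using sublinear_add[OF assms(1), of "x + s *\<^sub>R y" "- x"] sublinear_scale[OF assms(1) that, of y]
    by simp
  then show "bdd_below ((\<lambda>t. p (x + t *\<^sub>R y) - t * p y) ` {0..})"
    by (intro bdd_belowI2[where m = "- p (- x)"]) simp
qed (use assms in simp)

lemma lower_along_greatest:
  "(\<And>t. t \<ge> 0 \<Longrightarrow> m \<le> p (x + t *\<^sub>R y) - t * p y) \<Longrightarrow> m \<le> lower_along y p x"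
  unfolding lower_along_def by (rule cINF_greatest) auto

text \<open>
  Choose the parameters \<open>s\<close> and \<open>t\<close> for two points independently; \<open>s + t\<close> then serves for their
  sum. For a multiple of a point the parameter is scaled by the same factor.
\<close>

lemma sublinear_lower_along:
  assumes p: "sublinear p"
  shows "sublinear (lower_along y p)"
  unfolding sublinear_def
proof (intro conjI allI impI)
  fix x z
  have "lower_along y p (x + z) - lower_along y p z \<le> lower_along y p x"
  proof (rule lower_along_greatest)
    fix s :: real assume s: "s \<ge> 0"
    have "lower_along y p (x + z) - (p (x + s *\<^sub>R y) - s * p y) \<le> lower_along y p z"
    proof (rule lower_along_greatest)
      fix t :: real assume t: "t \<ge> 0"
      have "lower_along y p (x + z) \<le> p ((x + z) + (s + t) *\<^sub>R y) - (s + t) * p y"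
        using s t by (intro lower_along_le p) simp
      also have "(x + z) + (s + t) *\<^sub>R y = (x + s *\<^sub>R y) + (z + t *\<^sub>R y)"
        by (simp add: algebra_simps)
      finally show "lower_along y p (x + z) - (p (x + s *\<^sub>R y) - s * p y)
          \<le> p (z + t *\<^sub>R y) - t * p y"
        using sublinear_add[OF p, of "x + s *\<^sub>R y" "z + t *\<^sub>R y"] by (simp add: algebra_simps)
    qed
    then show "lower_along y p (x + z) - lower_along y p z \<le> p (x + s *\<^sub>R y) - s * p y"
      by simp
  qed
  then show "lower_along y p (x + z) \<le> lower_along y p x + lower_along y p z"
    by simp
next
  fix c :: real and x assume c: "c > 0"
  have "lower_along y p (c *\<^sub>R x) / c \<le> lower_along y p x"
  proof (rule lower_along_greatest)
    fix t :: real assume t: "t \<ge> 0"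
    have "lower_along y p (c *\<^sub>R x) \<le> p (c *\<^sub>R x + (c * t) *\<^sub>R y) - (c * t) * p y"
      using c t by (intro lower_along_le p) simp
    also have "c *\<^sub>R x + (c * t) *\<^sub>R y = c *\<^sub>R (x + t *\<^sub>R y)"
      by (simp add: algebra_simps)
    also have "p \<dots> = c * p (x + t *\<^sub>R y)"
      using c by (intro sublinear_scale p) simp
    finally show "lower_along y p (c *\<^sub>R x) / c \<le> p (x + t *\<^sub>R y) - t * p y"
      using c by (simp add: field_simps)
  qed
  then show "lower_along y p (c *\<^sub>R x) \<le> c * lower_along y p x"
    using c by (simp add: field_simps)
qed

text \<open>
  By Zorn's lemma it suffices that the pointwise infimum of a chain is sublinear. Two members of the
  chain, one nearly optimal at \<open>x\<close> and one at \<open>y\<close>, can be replaced by the smaller of the two; and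
  the infimum is finite since \<open>- q (- x)\<close> is a lower bound at \<open>x\<close>.
\<close>

lemma minimal_sublinear_exists:
  assumes q: "sublinear q"
  obtains p where "sublinear p" and "\<And>x. p x \<le> q x"
    and "\<And>r. sublinear r \<Longrightarrow> (\<And>x. r x \<le> p x) \<Longrightarrow> r = p"
proof -
  define A where "A = {p. sublinear p \<and> (\<forall>x. p x \<le> q x)}"
  define P where "P = (\<lambda>p r :: 'a \<Rightarrow> real. \<forall>x. r x \<le> p x)"
  have "\<exists>p\<in>A. \<forall>r\<in>A. P p r \<longrightarrow> r = p"
  proof (rule predicate_Zorn)
    show "partial_order_on A (relation_of P A)"
      by (rule partial_order_on_relation_ofI) (auto simp: P_def fun_eq_iff intro: order_trans antisym)
  next
    fix C assume C: "C \<in> Chains (relation_of P A)"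
    have CA: "r \<in> A" if "r \<in> C" for r
      using C that by (auto simp: Chains_def relation_of_def)
    have total: "P r s \<or> P s r" if "r \<in> C" "s \<in> C" for r s
      using C that by (auto simp: Chains_def relation_of_def)
    show "\<exists>u\<in>A. \<forall>r\<in>C. P r u"
    proof (cases "C = {}")
      case True
      then show ?thesis using q by (auto simp: A_def)
    next
      case False
      define u where "u x = (INF r\<in>C. r x)" for x
      have le: "u x \<le> r x" if "r \<in> C" for r x
        unfolding u_def
      proof (rule cINF_lower[OF _ that])
        show "bdd_below ((\<lambda>r. r x) ` C)"
        proof (rule bdd_belowI2[where m = "- q (- x)"])
          fix r assume "r \<in> C"
          then have "sublinear r" "r (- x) \<le> q (- x)"
            using CA by (auto simp: A_def)
          then show "- q (- x) \<le> r x"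
            using sublinear_neg[of r x] by simp
        qed
      qed
      have ge: "m \<le> u x" if "\<And>r. r \<in> C \<Longrightarrow> m \<le> r x" for m x
        unfolding u_def using False that by (rule cINF_greatest)
      have "sublinear u"
        unfolding sublinear_def
      proof (intro conjI allI impI)
        fix x y
        have "u (x + y) - u y \<le> u x"
        proof (rule ge)
          fix r assume r: "r \<in> C"
          have "u (x + y) - r x \<le> u y"
          proof (rule ge)
            fix s assume s: "s \<in> C"
            have "\<exists>t\<in>C. t x \<le> r x \<and> t y \<le> s y"
              using total[OF r s] r s by (auto simp: P_def)
            then obtain t where t: "t \<in> C" "t x \<le> r x" "t y \<le> s y"
              by blast
            have "t (x + y) \<le> t x + t y"
              using CA[OF t(1)] by (auto simp: A_def intro: sublinear_add)
            then show "u (x + y) - r x \<le> s y"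
              using le[OF t(1), of "x + y"] t by simp
          qed
          then show "u (x + y) - u y \<le> r x" by simp
        qed
        then show "u (x + y) \<le> u x + u y" by simp
      next
        fix c :: real and x assume c: "c > 0"
        have "u (c *\<^sub>R x) / c \<le> u x"
        proof (rule ge)
          fix r assume r: "r \<in> C"
          then have "r (c *\<^sub>R x) = c * r x"
            using CA c by (intro sublinear_scale) (auto simp: A_def)
          then show "u (c *\<^sub>R x) / c \<le> r x"
            using le[OF r, of "c *\<^sub>R x"] c by (simp add: field_simps)
        qed
        then show "u (c *\<^sub>R x) \<le> c * u x"
          using c by (simp add: field_simps)
      qed
      moreover have "u x \<le> q x" for x
      proof -
        obtain r where r: "r \<in> C" using False by blast
        then have "r x \<le> q x" using CA by (simp add: A_def)
        then show ?thesis using le[OF r, of x] by simp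
      qed
      ultimately show ?thesis
        using le by (auto simp: A_def P_def)
    qed
  qed
  then obtain p where p: "p \<in> A" "\<And>r. r \<in> A \<Longrightarrow> P p r \<Longrightarrow> r = p"
    by blast
  show ?thesis
  proof (rule that)
    fix r assume "sublinear r" "\<And>x. r x \<le> p x"
    then show "r = p"
      using p by (intro p(2)) (auto simp: A_def P_def intro: order_trans)
  qed (use p(1) in \<open>auto simp: A_def\<close>)
qed

text \<open>
  Minimality gives \<open>lower_along y p = p\<close> for every \<open>y\<close>, hence \<open>p (- y) = - p y\<close>.
  With this symmetry subadditivity turns into additivity.
\<close>

lemma minimal_sublinear_linear:
  assumes p: "sublinear p" and min: "\<And>r. sublinear r \<Longrightarrow> (\<And>x. r x \<le> p x) \<Longrightarrow> r = p"
  shows "linear p"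
proof
  have "lower_along y p = p" for y
    using lower_along_le[OF p order_refl, of y] by (intro min sublinear_lower_along p) simp
  then have "p (- y) \<le> - p y" for y
    using lower_along_le[OF p, of 1 y "- y"] by (simp add: sublinear_zero[OF p])
  then have neg: "p (- y) = - p y" for y
    using sublinear_neg[OF p, of "- y"] by (simp add: antisym)
  show "p (x + y) = p x + p y" for x y
    using sublinear_add[OF p, of "x + y" "- y"] sublinear_add[OF p, of x y] by (simp add: neg)
  show "p (c *\<^sub>R x) = c *\<^sub>R p x" for c x
    using sublinear_scale[OF p, of c x] sublinear_scale[OF p, of "- c" x] neg[of "c *\<^sub>R x"]
    by (cases "c \<ge> 0") auto
qed

text \<open>
  The norm, lowered along \<open>x0\<close>, dominates a minimal sublinear function. That function is linear,
  and it takes the value \<open>norm x0\<close> at \<open>x0\<close> because it is at most \<open>- norm x0\<close> at \<open>- x0\<close>.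
\<close>

lemma norming_functional_exists:
  fixes x0 :: "'a::real_normed_vector"
  obtains f :: "'a \<Rightarrow> real" where "linear f" and "\<And>x. \<bar>f x\<bar> \<le> norm x" and "f x0 = norm x0"
proof -
  have norm: "sublinear (norm :: 'a \<Rightarrow> real)"
    by (simp add: sublinear_def norm_triangle_ineq)
  obtain p where p: "sublinear p" "\<And>x. p x \<le> lower_along x0 norm x"
      "\<And>r. sublinear r \<Longrightarrow> (\<And>x. r x \<le> p x) \<Longrightarrow> r = p"
    using minimal_sublinear_exists[OF sublinear_lower_along[OF norm]] by metis
  have lin: "linear p"
    using p(1,3) by (rule minimal_sublinear_linear)
  have le: "p x \<le> norm x" for x
    using p(2)[of x] lower_along_le[OF norm order_refl, of x0 x] by simp
  have "p (- x0) \<le> - norm x0"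
    using p(2)[of "- x0"] lower_along_le[OF norm, of 1 x0 "- x0"] by simp
  then have "p x0 = norm x0"
    using le[of x0] by (simp add: linear_neg[OF lin])
  moreover have "\<bar>p x\<bar> \<le> norm x" for x
    using le[of x] le[of "- x"] by (simp add: linear_neg[OF lin])
  ultimately show ?thesis
    using lin that by blast
qed

section \<open>Set functions diagonal on singletons\<close>

text \<open>
  A real number is encoded by the set of its dyadic approximations. Distinct numbers share only the
  approximations that are too coarse to separate them.
\<close>

lemma uncountable_almost_disjoint_family:
  obtains A :: "real \<Rightarrow> nat set"
  where "\<And>x. infinite (A x)" and "\<And>x y. x \<noteq> y \<Longrightarrow> finite (A x \<inter> A y)"
proof -
  define A where "A x = range (\<lambda>n::nat. to_nat (n, \<lfloor>x * 2 ^ n\<rfloor>))" for x :: real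
  have "infinite (A x)" for x
    unfolding A_def by (rule range_inj_infinite) (simp add: inj_on_def)
  moreover have "finite (A x \<inter> A y)" if "x \<noteq> y" for x y
  proof -
    obtain N :: nat where N: "1 / \<bar>x - y\<bar> < 2 ^ N"
      using real_arch_pow[of 2 "1 / \<bar>x - y\<bar>"] by auto
    have "A x \<inter> A y \<subseteq> (\<lambda>n. to_nat (n, \<lfloor>x * 2 ^ n\<rfloor>)) ` {..<N}"
    proof
      fix k assume "k \<in> A x \<inter> A y"
      then obtain n where n: "k = to_nat (n, \<lfloor>x * 2 ^ n\<rfloor>)" "\<lfloor>x * 2 ^ n\<rfloor> = \<lfloor>y * 2 ^ n\<rfloor>"
        by (auto simp: A_def)
      have "\<bar>x * 2 ^ n - y * 2 ^ n\<bar> < 1"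
        using n(2) by linarith
      then have "\<bar>x - y\<bar> * 2 ^ n < 1"
        by (simp add: abs_mult flip: left_diff_distrib)
      also have "1 < \<bar>x - y\<bar> * 2 ^ N"
        using N that by (simp add: field_simps)
      finally have "2 ^ n < (2::real) ^ N"
        by (rule mult_left_less_imp_less) simp
      then have "n < N" by simp
      then show "k \<in> (\<lambda>n. to_nat (n, \<lfloor>x * 2 ^ n\<rfloor>)) ` {..<N}"
        using n(1) by blast
    qed
    then show ?thesis by (rule finite_subset) simp
  qed
  ultimately show ?thesis using that by blast
qed

lemma additive_sum:
  fixes d :: "'i set \<Rightarrow> real"
  assumes add: "\<And>A B. A \<inter> B = {} \<Longrightarrow> d (A \<union> B) = d A + d B"
    and "finite F" and "disjoint_family_on B F"
  shows "d (\<Union>x\<in>F. B x) = (\<Sum>x\<in>F. d (B x))"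
  using assms(2,3)
proof (induction F)
  case empty
  show ?case using add[of "{}" "{}"] by simp
next
  case (insert x F)
  have "B x \<inter> (\<Union>y\<in>F. B y) = {}"
    using insert by (auto simp: disjoint_family_on_def)
  then show ?case
    using insert add by (simp add: disjoint_family_on_insert)
qed

text \<open>
  This is the core of the theorem that \<open>c\<^sub>0\<close> is not complemented in \<open>\<ell>\<^sub>\<infinity>\<close>. Subtract from \<open>\<mu> k\<close> the
  point mass at \<open>k\<close>; the difference \<open>d k\<close> ignores finite sets. If \<open>\<mu> k A\<close> tends to zero for an
  infinite set \<open>A\<close>, then \<open>d k A\<close> is at most \<open>- c / 2\<close> for some \<open>k\<close> in \<open>A\<close>. Over an uncountable
  almost disjoint family, infinitely many members must share the same \<open>k\<close>. They become disjoint
  after the removal of finite sets, so additivity contradicts the boundedness of \<open>d k\<close>.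
\<close>

lemma no_vanishing_diagonal_set_functions:
  fixes \<mu> :: "nat \<Rightarrow> nat set \<Rightarrow> real"
  assumes add: "\<And>k A B. A \<inter> B = {} \<Longrightarrow> \<mu> k (A \<union> B) = \<mu> k A + \<mu> k B"
    and bounded: "\<And>k A. \<bar>\<mu> k A\<bar> \<le> K"
    and off_diagonal: "\<And>k l. l \<noteq> k \<Longrightarrow> \<mu> k {l} = 0"
    and "c > 0" and diagonal: "\<And>k. c \<le> \<mu> k {k}"
  shows "\<exists>A. \<not> (\<lambda>k. \<mu> k A) \<longlonglongrightarrow> 0"
proof (rule ccontr)
  assume "\<nexists>A. \<not> (\<lambda>k. \<mu> k A) \<longlonglongrightarrow> 0"
  then have null: "(\<lambda>k. \<mu> k A) \<longlonglongrightarrow> 0" for A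
    by blast
  define d where "d k A = \<mu> k A - (if k \<in> A then \<mu> k {k} else 0)" for k A
  have d_add: "d k (A \<union> B) = d k A + d k B" if "A \<inter> B = {}" for k A B
    using add[OF that, of k] that by (auto simp: d_def)
  have "d k {l} = 0" for k l
    using off_diagonal[of l k] by (simp add: d_def)
  then have d_finite: "d k A = 0" if "finite A" for k A
    using additive_sum[of "d k" A "\<lambda>x. {x}", OF d_add that]
    by (simp add: disjoint_family_on_def)
  have d_bound: "- (2 * K) \<le> d k A" for k A
    using bounded[of k A] bounded[of k "{k}"] bounded[of k "{}"] by (auto simp: d_def)
  obtain A :: "real \<Rightarrow> nat set"
    where inf: "\<And>x. infinite (A x)" and ad: "\<And>x y. x \<noteq> y \<Longrightarrow> finite (A x \<inter> A y)"
    using uncountable_almost_disjoint_family by blast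
  have "\<exists>k. d k (A x) \<le> - (c / 2)" for x
  proof -
    have "eventually (\<lambda>k. \<mu> k (A x) < c / 2) sequentially"
      using order_tendstoD(2)[OF null[of "A x"], of "c / 2"] \<open>c > 0\<close> by simp
    then obtain N where N: "\<And>k. k \<ge> N \<Longrightarrow> \<mu> k (A x) < c / 2"
      by (auto simp: eventually_sequentially)
    obtain k where "k \<ge> N" "k \<in> A x"
      using inf[of x] by (auto simp: infinite_nat_iff_unbounded_le)
    then have "d k (A x) \<le> - (c / 2)"
      using N[of k] diagonal[of k] by (simp add: d_def)
    then show ?thesis ..
  qed
  then have cover: "(\<Union>k. {x. d k (A x) \<le> - (c / 2)}) = UNIV"
    by blast
  have "\<exists>k. infinite {x. d k (A x) \<le> - (c / 2)}"
  proof (rule ccontr)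
    assume "\<nexists>k. infinite {x. d k (A x) \<le> - (c / 2)}"
    then have "countable (\<Union>k. {x. d k (A x) \<le> - (c / 2)})"
      by (intro countable_UN[OF _ countable_finite]) auto
    then show False
      unfolding cover using uncountable_UNIV_real by simp
  qed
  then obtain k where "infinite {x. d k (A x) \<le> - (c / 2)}" ..
  moreover obtain n :: nat where n: "2 * K < real n * (c / 2)"
    using reals_Archimedean3[of "c / 2"] \<open>c > 0\<close> half_gt_zero by blast
  ultimately obtain F where F: "finite F" "card F = n" "F \<subseteq> {x. d k (A x) \<le> - (c / 2)}"
    using infinite_arbitrarily_large by metis
  define E where "E = (\<Union>x\<in>F. \<Union>y\<in>F - {x}. A x \<inter> A y)"
  have "finite E"
    unfolding E_def using F(1) by (intro finite_UN_I finite_Diff ad) auto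
  have dE: "d k (A x - E) = d k (A x)" for x
  proof -
    have "d k ((A x - E) \<union> (A x \<inter> E)) = d k (A x - E) + d k (A x \<inter> E)"
      by (rule d_add) blast
    moreover have "(A x - E) \<union> (A x \<inter> E) = A x"
      by blast
    moreover have "d k (A x \<inter> E) = 0"
      using \<open>finite E\<close> by (intro d_finite finite_Int) simp
    ultimately show ?thesis by simp
  qed
  have "disjoint_family_on (\<lambda>x. A x - E) F"
    by (auto simp: disjoint_family_on_def E_def)
  then have "d k (\<Union>x\<in>F. A x - E) = (\<Sum>x\<in>F. d k (A x - E))"
    by (intro additive_sum d_add F(1))
  also have "\<dots> = (\<Sum>x\<in>F. d k (A x))"
    by (simp add: dE)
  also have "\<dots> \<le> real (card F) * (- (c / 2))"
    using F(3) by (intro sum_bounded_above) auto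
  finally show False
    using d_bound[of k "\<Union>x\<in>F. A x - E"] n F(2) by simp
qed

section \<open>Restrictions and shifts of bounded sequences\<close>

lemma apply_sum_linf:
  fixes u :: "'i \<Rightarrow> 'a::real_normed_vector linf"
  shows "apply_bcontfun (\<Sum>k\<in>F. u k) i = (\<Sum>k\<in>F. apply_bcontfun (u k) i)"
  by (induction F rule: infinite_finite_induct) simp_all

lemma apply_Bcontfun_nat:
  fixes f :: "nat \<Rightarrow> 'a::real_normed_vector"
  assumes "\<And>i. norm (f i) \<le> K"
  shows "apply_bcontfun (Bcontfun f) = f"
  using assms by (intro Bcontfun_inverse bcontfun_normI) simp_all

definition restrict_linf :: "nat set \<Rightarrow> 'a::real_normed_vector linf \<Rightarrow> 'a linf" where
  "restrict_linf I f = Bcontfun (\<lambda>i. if i \<in> I then apply_bcontfun f i else 0)"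

lemma apply_restrict_linf [simp]:
  "apply_bcontfun (restrict_linf I f) i = (if i \<in> I then apply_bcontfun f i else 0)"
  unfolding restrict_linf_def
  by (subst apply_Bcontfun_nat[where K = "norm f"]) (simp_all add: norm_bounded)

lemma norm_restrict_linf: "norm (restrict_linf I f) \<le> norm f"
  by (rule norm_bound) (simp add: norm_bounded)

definition shift_linf :: "nat \<Rightarrow> 'a::real_normed_vector linf \<Rightarrow> 'a linf" where
  "shift_linf m f = Bcontfun (\<lambda>i. if i < m then 0 else apply_bcontfun f (i - m))"

lemma apply_shift_linf [simp]:
  "apply_bcontfun (shift_linf m f) i = (if i < m then 0 else apply_bcontfun f (i - m))"
  unfolding shift_linf_def
  by (subst apply_Bcontfun_nat[where K = "norm f"]) (simp_all add: norm_bounded)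

lemma norm_shift_linf [simp]: "norm (shift_linf m f) = norm f"
proof (rule antisym)
  show "norm (shift_linf m f) \<le> norm f"
    by (rule norm_bound) (simp add: norm_bounded)
  show "norm f \<le> norm (shift_linf m f)"
  proof (rule norm_bound)
    show "norm (apply_bcontfun f i) \<le> norm (shift_linf m f)" for i
      using norm_bounded[of "shift_linf m f" "i + m"] by simp
  qed
qed

lemma c0_add: "f \<in> c0 \<Longrightarrow> g \<in> c0 \<Longrightarrow> f + g \<in> c0"
  using tendsto_add[of "apply_bcontfun f" 0 sequentially "apply_bcontfun g" 0]
  by (simp add: c0_def plus_bcontfun.rep_eq)

lemma c0_scaleR: "f \<in> c0 \<Longrightarrow> r *\<^sub>R f \<in> c0"
  using tendsto_scaleR[OF tendsto_const, of "apply_bcontfun f" 0 sequentially r]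
  by (simp add: c0_def scaleR_bcontfun.rep_eq)

lemma c0_diff: "f \<in> c0 \<Longrightarrow> g \<in> c0 \<Longrightarrow> f - g \<in> c0"
  using c0_add[of f "(- 1) *\<^sub>R g"] c0_scaleR[of g "- 1"] by simp

lemma c0_finite_support: "(\<And>i. i \<ge> p \<Longrightarrow> apply_bcontfun f i = 0) \<Longrightarrow> f \<in> c0"
  unfolding c0_def by (auto intro!: tendsto_eventually eventually_sequentiallyI)

lemma c0_shift_linf: "f \<in> c0 \<Longrightarrow> shift_linf m f \<in> c0"
  unfolding c0_def using LIMSEQ_offset[of "apply_bcontfun (shift_linf m f)" m 0] by simp

section \<open>Linear maps on subspaces\<close>

lemma linear_map_on_scaleR:
  assumes "banach_space_over s1" and "banach_space_over s2"
    and "linear_map_on s1 s2 S f" and "x \<in> S"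
  shows "f (r *\<^sub>R x) = r *\<^sub>R f x"
proof -
  interpret s1: banach_space_over s1 by fact
  interpret s2: banach_space_over s2 by fact
  have "f (s1 (of_real r) x) = s2 (of_real r) (f x)"
    using assms unfolding linear_map_on_def by blast
  then show ?thesis
    by (simp add: s1.scale_of_real s2.scale_of_real)
qed

lemma linear_continuous_imp_bounded_on:
  fixes f :: "'a::real_normed_vector \<Rightarrow> 'b::real_normed_vector"
  assumes scale: "\<And>r x. x \<in> S \<Longrightarrow> r *\<^sub>R x \<in> S \<and> f (r *\<^sub>R x) = r *\<^sub>R f x"
    and cont: "continuous_on S f"
  shows "\<exists>B>0. \<forall>x\<in>S. norm (f x) \<le> B * norm x"
proof (cases "S = {}")
  case False
  then have zero: "0 \<in> S" "f 0 = 0"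
    using scale[of _ 0] by auto
  then obtain d where d: "d > 0" "\<And>x. x \<in> S \<Longrightarrow> norm x < d \<Longrightarrow> norm (f x) < 1"
    using cont unfolding continuous_on_iff by (metis dist_0_norm dist_commute zero_less_one)
  have "norm (f x) \<le> 2 / d * norm x" if "x \<in> S" for x
  proof (cases "x = 0")
    case nonzero: False
    define r where "r = d / (2 * norm x)"
    have r: "r > 0" "norm (r *\<^sub>R x) < d"
      using nonzero d(1) by (auto simp: r_def)
    then have "r * norm (f x) < 1"
      using d(2)[of "r *\<^sub>R x"] scale[OF that, of r] by simp
    then show ?thesis
      using nonzero d(1) by (simp add: r_def field_simps)
  qed (simp add: zero)
  then show ?thesis
    using d(1) by (intro exI[of _ "2 / d"]) simp
qed (auto intro: exI[of _ 1])

section \<open>Humps\<close>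

text \<open>
  The data \<open>m\<close>, \<open>n\<close> and \<open>e\<close> are prescribed. The next hump of a gliding sequence may start at the end
  \<open>p\<close> of the support, and a functional norming the entry at the peak \<open>j\<close> will detect \<open>u\<close>.
\<close>

definition is_hump ::
    "('a::real_normed_vector linf \<Rightarrow> 'b::real_normed_vector linf) \<Rightarrow> nat \<Rightarrow> nat \<Rightarrow> real \<Rightarrow>
      'a linf \<Rightarrow> nat \<Rightarrow> nat \<Rightarrow> bool" where
  "is_hump T m n e u p j \<longleftrightarrow>
    norm u \<le> 1 \<and> (\<forall>i. i < m \<or> i \<ge> p \<longrightarrow> apply_bcontfun u i = 0) \<and>
    m \<le> j \<and> j < p \<and> 1 / 2 \<le> norm (apply_bcontfun u j) \<and>
    (\<forall>i<n. norm (apply_bcontfun (T u) i) \<le> e)"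

text \<open>
  The map \<open>G\<close> in the proof shifts \<open>c\<^sub>0(X)\<close> to the tail beyond \<open>m\<close>, applies \<open>T\<close> and keeps finitely
  many coordinates. It has all properties of an embedding into a power of \<open>Y\<close> except a lower bound,
  so some vector is nearly annihilated; normalised and cut off far out, it is a hump.
\<close>

lemma hump_exists:
  fixes scaleX :: "'k::real_normed_field \<Rightarrow> 'a::banach \<Rightarrow> 'a"
    and scaleY :: "'k \<Rightarrow> 'b::banach \<Rightarrow> 'b"
    and T :: "'a linf \<Rightarrow> 'b linf"
  assumes X: "banach_space_over scaleX" and Y: "banach_space_over scaleY"
    and no_embedding: "\<And>n::nat. n \<ge> 1 \<Longrightarrow>
      \<not> (\<exists>T. linear_embedding (linf_scale scaleX) (linf_scale scaleY)
            (c0 :: 'a linf set) (npower n :: 'b linf set) T)"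
    and T: "bounded_linear_map_on (linf_scale scaleX) (linf_scale scaleY) c0 T"
    and e: "e > 0"
  shows "\<exists>u p j. is_hump T m n e u p j"
proof -
  interpret X: banach_space_over scaleX by fact
  interpret Y: banach_space_over scaleY by fact
  have lin: "linear_map_on (linf_scale scaleX) (linf_scale scaleY) c0 T"
    using T by (simp add: bounded_linear_map_on_def)
  have T_add: "T (x + y) = T x + T y" if "x \<in> c0" "y \<in> c0" for x y
    using lin that by (simp add: linear_map_on_def)
  have T_scale: "T (linf_scale scaleX c x) = linf_scale scaleY c (T x)" if "x \<in> c0" for x c
    using lin that by (simp add: linear_map_on_def)
  have T_scaleR: "T (r *\<^sub>R x) = r *\<^sub>R T x" if "x \<in> c0" for x r
    by (rule linear_map_on_scaleR[OF X.banach_space_over_linf Y.banach_space_over_linf lin that])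
  obtain B0 where B0: "\<And>x. x \<in> c0 \<Longrightarrow> norm (T x) \<le> B0 * norm x"
    using T by (auto simp: bounded_linear_map_on_def)
  define B where "B = max B0 1"
  have T_bound: "norm (T x) \<le> B * norm x" if "x \<in> c0" for x
    using B0[OF that] mult_right_mono[of B0 B "norm x"] by (auto simp: B_def intro: order_trans)
  have B: "B > 0"
    by (simp add: B_def)
  (* The power of Y must be positive, hence Suc n and not n. *)
  define G where "G v = restrict_linf {..<Suc n} (T (shift_linf m v))" for v
  have G_lin: "linear_map_on (linf_scale scaleX) (linf_scale scaleY) c0 G"
    unfolding linear_map_on_def
  proof (intro conjI ballI allI)
    fix x y :: "'a linf" assume xy: "x \<in> c0" "y \<in> c0"
    have "shift_linf m (x + y) = shift_linf m x + shift_linf m y"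
      by (rule bcontfun_eqI) simp
    then have "T (shift_linf m (x + y)) = T (shift_linf m x) + T (shift_linf m y)"
      using xy by (simp add: T_add c0_shift_linf)
    then show "G (x + y) = G x + G y"
      by (intro bcontfun_eqI) (simp add: G_def)
  next
    fix c :: 'k and x :: "'a linf" assume x: "x \<in> c0"
    have "shift_linf m (linf_scale scaleX c x) = linf_scale scaleX c (shift_linf m x)"
      by (rule bcontfun_eqI) (simp add: X.apply_linf_scale)
    then have "T (shift_linf m (linf_scale scaleX c x)) = linf_scale scaleY c (T (shift_linf m x))"
      using x by (simp add: T_scale c0_shift_linf)
    then show "G (linf_scale scaleX c x) = linf_scale scaleY c (G x)"
      by (intro bcontfun_eqI) (simp add: G_def Y.apply_linf_scale)
  qed
  have G_bound: "norm (G x) \<le> B * norm x" if "x \<in> c0" for x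
    using norm_restrict_linf[of "{..<Suc n}" "T (shift_linf m x)"]
      T_bound[OF c0_shift_linf[OF that], of m] by (simp add: G_def)
  have "G ` c0 \<subseteq> npower (Suc n)"
    by (auto simp: npower_def G_def)
  moreover have "\<exists>B. \<forall>x\<in>c0. norm (G x) \<le> B * norm x"
    using G_bound by blast
  moreover have "\<not> linear_embedding (linf_scale scaleX) (linf_scale scaleY) c0 (npower (Suc n)) G"
    using no_embedding[of "Suc n"] by auto
  ultimately have "\<not> (\<exists>C>0. \<forall>x\<in>c0. C * norm x \<le> norm (G x))"
    using G_lin by (simp add: linear_embedding_def bounded_linear_map_on_def)
  then have "\<not> (\<forall>x\<in>c0. e / 2 * norm x \<le> norm (G x))"
    using half_gt_zero[OF e] by blast
  then obtain v where v: "v \<in> c0" "norm (G v) < e / 2 * norm v"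
    by (auto simp: not_le)
  have "0 < e / 2 * norm v"
    using v(2) norm_ge_zero[of "G v"] by linarith
  then have v0: "norm v > 0"
    using e by (simp add: zero_less_mult_iff)
  define u0 where "u0 = (1 / norm v) *\<^sub>R shift_linf m v"
  have u0: "u0 \<in> c0" "norm u0 = 1"
    using v v0 by (auto simp: u0_def intro!: c0_scaleR c0_shift_linf)
  have u0_small: "norm (apply_bcontfun (T u0) i) \<le> e / 2" if "i < n" for i
  proof -
    have "norm (apply_bcontfun (T (shift_linf m v)) i) \<le> norm (G v)"
      using norm_bounded[of "G v" i] that by (simp add: G_def)
    also have "\<dots> \<le> e / 2 * norm v"
      using v by simp
    finally show ?thesis
      using v v0 by (simp add: u0_def T_scaleR c0_shift_linf field_simps)
  qed
  (* Cutting off entries below d costs at most e / 2 in T u and keeps the entries above 1 / 2. *)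
  define d where "d = min (1 / 2) (e / (2 * B))"
  have d: "d > 0" "d \<le> 1 / 2" "B * d \<le> e / 2"
  proof -
    have "B * d \<le> B * (e / (2 * B))"
      using B by (intro mult_left_mono) (simp_all add: d_def)
    then show "B * d \<le> e / 2" using B by simp
  qed (use e B in \<open>auto simp: d_def\<close>)
  obtain p where p: "\<And>i. i \<ge> p \<Longrightarrow> norm (apply_bcontfun u0 i) < d"
    using u0(1) d(1) unfolding c0_def by (auto simp: LIMSEQ_iff)
  have "\<exists>j. 1 / 2 < norm (apply_bcontfun u0 j)"
  proof (rule ccontr)
    assume "\<nexists>j. 1 / 2 < norm (apply_bcontfun u0 j)"
    then have "norm u0 \<le> 1 / 2"
      by (intro norm_bound) (simp add: not_less)
    then show False using u0(2) by simp
  qed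
  then obtain j where j: "1 / 2 < norm (apply_bcontfun u0 j)" ..
  have "j < p"
    using p[of j] j d(2) by (cases "j < p") auto
  have "m \<le> j"
    using j by (cases "j < m") (auto simp: u0_def)
  define u where "u = restrict_linf {..<p} u0"
  have u: "u \<in> c0"
    by (rule c0_finite_support[of p]) (simp add: u_def)
  have diff: "norm (u - u0) \<le> d"
  proof (rule norm_bound)
    show "norm (apply_bcontfun (u - u0) i) \<le> d" for i
      using p[of i] d(1) by (auto simp: u_def)
  qed
  have "norm (apply_bcontfun (T u) i) \<le> e" if "i < n" for i
  proof -
    have "T u = T u0 + T (u - u0)"
      using T_add[OF u0(1) c0_diff[OF u u0(1)]] by simp
    then have "norm (apply_bcontfun (T u) i)
        \<le> norm (apply_bcontfun (T u0) i) + norm (apply_bcontfun (T (u - u0)) i)"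
      by (simp add: norm_triangle_ineq)
    also have "norm (apply_bcontfun (T (u - u0)) i) \<le> B * norm (u - u0)"
      using T_bound[OF c0_diff[OF u u0(1)]] norm_bounded order_trans by blast
    also have "\<dots> \<le> e / 2"
      using order_trans[OF mult_left_mono[OF diff less_imp_le[OF B]] d(3)] .
    finally show ?thesis
      using u0_small[OF that] by simp
  qed
  moreover have "norm u \<le> 1"
    using norm_restrict_linf[of "{..<p}" u0] u0(2) by (simp add: u_def)
  moreover have "apply_bcontfun u i = 0" if "i < m \<or> i \<ge> p" for i
    using that by (auto simp: u_def u0_def)
  moreover have "1 / 2 \<le> norm (apply_bcontfun u j)"
    using j \<open>j < p\<close> by (simp add: u_def)
  ultimately show ?thesis
    using \<open>m \<le> j\<close> \<open>j < p\<close> unfolding is_hump_def by blast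
qed

section \<open>Coordinatewise sums over sets of indices\<close>

text \<open>
  The series need not converge in norm. Under the assumptions of the context below each coordinate
  converges, as its terms are dominated by a geometric series from some index on, and the bound
  on finite sums passes to the limit.
\<close>

definition block_sum :: "(nat \<Rightarrow> 'a::banach linf) \<Rightarrow> nat set \<Rightarrow> 'a linf" where
  "block_sum w A = Bcontfun (\<lambda>i. \<Sum>k. if k \<in> A then apply_bcontfun (w k) i else 0)"

context
  fixes w :: "nat \<Rightarrow> 'a::banach linf" and K :: real
  assumes bounded_sums: "\<And>F. finite F \<Longrightarrow> norm (\<Sum>k\<in>F. w k) \<le> K"
    and small: "\<And>k i. i \<le> k \<Longrightarrow> norm (apply_bcontfun (w k) i) \<le> (1 / 2) ^ k"
begin

lemma summable_block_sum: "summable (\<lambda>k. if k \<in> A then apply_bcontfun (w k) i else 0)"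
  by (rule summable_comparison_test'[of "\<lambda>k. (1 / 2) ^ k" i]) (auto simp: small)

lemma norm_block_sum_at: "norm (\<Sum>k. if k \<in> A then apply_bcontfun (w k) i else 0) \<le> K"
proof (rule Lim_norm_ubound[OF sequentially_bot summable_LIMSEQ[OF summable_block_sum]])
  have "norm (\<Sum>k<n. if k \<in> A then apply_bcontfun (w k) i else 0) \<le> K" for n
  proof -
    have "(\<Sum>k<n. if k \<in> A then apply_bcontfun (w k) i else 0)
        = apply_bcontfun (\<Sum>k\<in>{..<n} \<inter> A. w k) i"
      by (subst apply_sum_linf) (simp add: sum.inter_restrict)
    then show ?thesis
      using norm_bounded[of "\<Sum>k\<in>{..<n} \<inter> A. w k" i] bounded_sums[of "{..<n} \<inter> A"] by simp
  qed
  then show "\<forall>\<^sub>F n in sequentially. norm (\<Sum>k<n. if k \<in> A then apply_bcontfun (w k) i else 0) \<le> K"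
    by simp
qed

lemma apply_block_sum:
  "apply_bcontfun (block_sum w A) i = (\<Sum>k. if k \<in> A then apply_bcontfun (w k) i else 0)"
  unfolding block_sum_def by (subst apply_Bcontfun_nat[OF norm_block_sum_at]) simp

lemma norm_block_sum: "norm (block_sum w A) \<le> K"
  by (rule norm_bound) (simp add: apply_block_sum norm_block_sum_at)

lemma block_sum_Un:
  assumes "A \<inter> B = {}"
  shows "block_sum w (A \<union> B) = block_sum w A + block_sum w B"
proof (rule bcontfun_eqI)
  fix i
  have "(\<lambda>k. if k \<in> A \<union> B then apply_bcontfun (w k) i else 0) =
      (\<lambda>k. (if k \<in> A then apply_bcontfun (w k) i else 0) + (if k \<in> B then apply_bcontfun (w k) i else 0))"
    using assms by (auto simp: fun_eq_iff)
  then show "apply_bcontfun (block_sum w (A \<union> B)) i = apply_bcontfun (block_sum w A + block_sum w B) i"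
    by (simp add: apply_block_sum suminf_add[OF summable_block_sum summable_block_sum])
qed

lemma block_sum_singleton: "block_sum w {l} = w l"
proof (rule bcontfun_eqI)
  fix i
  have "(\<Sum>k. if k \<in> {l} then apply_bcontfun (w k) i else 0) =
      (\<Sum>k\<in>{l}. if k \<in> {l} then apply_bcontfun (w k) i else 0)"
    by (rule suminf_finite) auto
  then show "apply_bcontfun (block_sum w {l}) i = apply_bcontfun (w l) i"
    by (simp add: apply_block_sum)
qed

end

lemma norm_sum_disjoint_support:
  fixes u :: "'i \<Rightarrow> 'a::real_normed_vector linf"
  assumes "finite F" and "c \<ge> 0" and "\<And>k. norm (u k) \<le> c"
    and disjoint: "\<And>k l i. k \<noteq> l \<Longrightarrow> apply_bcontfun (u k) i = 0 \<or> apply_bcontfun (u l) i = 0"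
  shows "norm (\<Sum>k\<in>F. u k) \<le> c"
proof (rule norm_bound)
  fix i
  show "norm (apply_bcontfun (\<Sum>k\<in>F. u k) i) \<le> c"
  proof (cases "\<exists>k\<in>F. apply_bcontfun (u k) i \<noteq> 0")
    case True
    then obtain k where k: "k \<in> F" "apply_bcontfun (u k) i \<noteq> 0" by blast
    have "(\<Sum>l\<in>F. apply_bcontfun (u l) i) = (\<Sum>l\<in>F. if l = k then apply_bcontfun (u k) i else 0)"
      using disjoint k by (intro sum.cong) auto
    also have "\<dots> = apply_bcontfun (u k) i"
      using assms(1) k(1) by simp
    finally show ?thesis
      using norm_bounded[of "u k" i] assms(3)[of k] by (simp add: apply_sum_linf)
  next
    case False
    then show ?thesis using assms(2) by (simp add: apply_sum_linf)
  qed
qed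

section \<open>Complemented copies of the null sequences\<close>

text \<open>
  The humps make \<open>R A\<close>, the coordinatewise sum of the \<open>T (u k)\<close> with \<open>k\<close> in \<open>A\<close>, meaningful for
  every set \<open>A\<close>. As \<open>S (R {k}) = u k\<close>, the coordinates of \<open>S (R A)\<close> at the peaks \<open>j k\<close> of the humps
  yield set functions that see on singletons only the diagonal, yet tend to zero on every set.
\<close>

lemma no_left_inverse_on_c0:
  fixes T :: "'a::real_normed_vector linf \<Rightarrow> 'b::banach linf" and S :: "'b linf \<Rightarrow> 'a linf"
  assumes humps: "\<And>m n e. e > 0 \<Longrightarrow> \<exists>u p j. is_hump T m n e u p j"
    and T_add: "\<And>x y. x \<in> c0 \<Longrightarrow> y \<in> c0 \<Longrightarrow> T (x + y) = T x + T y"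
    and T_bound: "\<And>x. x \<in> c0 \<Longrightarrow> norm (T x) \<le> B * norm x" and B: "B \<ge> 0"
    and S_add: "\<And>x y. S (x + y) = S x + S y"
    and S_bound: "\<And>y. norm (S y) \<le> D * norm y" and D: "D \<ge> 0"
    and S_c0: "\<And>y. S y \<in> c0"
    and left_inverse: "\<And>x. x \<in> c0 \<Longrightarrow> S (T x) = x"
  shows False
proof -
  have "\<forall>m k. \<exists>u p j. is_hump T m (Suc k) ((1 / 2) ^ k) u p j"
    by (intro allI humps) simp
  then obtain U P J where UPJ: "\<And>m k. is_hump T m (Suc k) ((1 / 2) ^ k) (U m k) (P m k) (J m k)"
    by metis
  (* Each hump starts where the support of the previous one ends. *)
  define p where "p = rec_nat 0 (\<lambda>k m. P m k)"
  have p_Suc: "p (Suc k) = P (p k) k" for k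
    by (simp add: p_def)
  define u where "u k = U (p k) k" for k
  define j where "j k = J (p k) k" for k
  have j: "p k \<le> j k" "j k < p (Suc k)" for k
    using UPJ[of "p k" k] by (simp_all add: is_hump_def j_def p_Suc)
  have p_mono: "p k \<le> p l" if "k \<le> l" for k l
    using lift_Suc_mono_le[of p, OF _ that] j by (meson le_trans less_imp_le)
  have u_supp: "apply_bcontfun (u k) i = 0" if "i < p k \<or> p (Suc k) \<le> i" for k i
    using that UPJ[of "p k" k] by (auto simp: is_hump_def u_def p_Suc)
  have u_norm: "norm (u k) \<le> 1" for k
    using UPJ[of "p k" k] by (simp add: is_hump_def u_def)
  have u_c0: "u k \<in> c0" for k
    by (rule c0_finite_support[of "p (Suc k)"]) (simp add: u_supp)
  have u_disjoint: "apply_bcontfun (u k) i = 0 \<or> apply_bcontfun (u l) i = 0" if "k \<noteq> l" for k l i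
  proof (cases "k < l")
    case True
    then show ?thesis using p_mono[of "Suc k" l] u_supp[of i k] u_supp[of i l] by force
  next
    case False
    then show ?thesis using that p_mono[of "Suc l" k] u_supp[of i k] u_supp[of i l] by force
  qed
  have u_big: "1 / 2 \<le> norm (apply_bcontfun (u k) (j k))" for k
    using UPJ[of "p k" k] by (simp add: is_hump_def u_def j_def)
  have sum_c0: "(\<Sum>k\<in>F. u k) \<in> c0 \<and> T (\<Sum>k\<in>F. u k) = (\<Sum>k\<in>F. T (u k))" if "finite F" for F
    using that
  proof (induction F)
    case empty
    have "0 \<in> (c0 :: 'a linf set)"
      by (rule c0_finite_support) simp
    then show ?case using T_bound[of 0] by simp
  qed (simp add: T_add u_c0 c0_add)
  have sums: "norm (\<Sum>k\<in>F. T (u k)) \<le> B" if "finite F" for F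
  proof -
    have "norm (T (\<Sum>k\<in>F. u k)) \<le> B * norm (\<Sum>k\<in>F. u k)"
      using sum_c0[OF that] by (intro T_bound) simp
    also have "\<dots> \<le> B * 1"
      by (intro mult_left_mono norm_sum_disjoint_support that u_norm u_disjoint B) simp_all
    finally show ?thesis
      using sum_c0[OF that] by simp
  qed
  have small: "norm (apply_bcontfun (T (u k)) i) \<le> (1 / 2) ^ k" if "i \<le> k" for i k
    using that UPJ[of "p k" k] by (simp add: is_hump_def u_def less_Suc_eq_le)
  define R where "R = block_sum (\<lambda>k. T (u k))"
  have R_Un: "R (A \<union> A') = R A + R A'" if "A \<inter> A' = {}" for A A'
    unfolding R_def using sums small that by (rule block_sum_Un)
  have R_single: "R {l} = T (u l)" for l
    unfolding R_def using sums small by (rule block_sum_singleton)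
  have R_norm: "norm (R A) \<le> B" for A
    unfolding R_def using sums small by (rule norm_block_sum)
  have "\<exists>f :: 'a \<Rightarrow> real. linear f \<and> (\<forall>x. \<bar>f x\<bar> \<le> norm x) \<and>
      f (apply_bcontfun (u k) (j k)) = norm (apply_bcontfun (u k) (j k))" for k
    using norming_functional_exists by metis
  then obtain f :: "nat \<Rightarrow> 'a \<Rightarrow> real" where f: "\<And>k. linear (f k)" "\<And>k x. \<bar>f k x\<bar> \<le> norm x"
      "\<And>k. f k (apply_bcontfun (u k) (j k)) = norm (apply_bcontfun (u k) (j k))"
    by metis
  define \<mu> where "\<mu> k A = f k (apply_bcontfun (S (R A)) (j k))" for k A
  have "\<exists>A. \<not> (\<lambda>k. \<mu> k A) \<longlonglongrightarrow> 0"
  proof (rule no_vanishing_diagonal_set_functions[of \<mu> "D * B" "1 / 2"])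
    show "\<mu> k (A \<union> A') = \<mu> k A + \<mu> k A'" if "A \<inter> A' = {}" for k A A'
      using that by (simp add: \<mu>_def R_Un S_add linear_add[OF f(1)])
    show "\<bar>\<mu> k A\<bar> \<le> D * B" for k A
    proof -
      have "\<bar>\<mu> k A\<bar> \<le> norm (S (R A))"
        using f(2) norm_bounded order_trans unfolding \<mu>_def by blast
      also have "\<dots> \<le> D * norm (R A)" by (rule S_bound)
      also have "\<dots> \<le> D * B" by (rule mult_left_mono[OF R_norm D])
      finally show ?thesis .
    qed
    have \<mu>_single: "\<mu> k {l} = f k (apply_bcontfun (u l) (j k))" for k l
      by (simp add: \<mu>_def R_single left_inverse u_c0)
    show "\<mu> k {l} = 0" if "l \<noteq> k" for k l
    proof -
      have "apply_bcontfun (u l) (j k) = 0"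
        using u_disjoint[OF that, of "j k"] u_big[of k] by auto
      then show ?thesis by (simp add: \<mu>_single linear_0[OF f(1)])
    qed
    show "1 / 2 \<le> \<mu> k {k}" for k
      using u_big by (simp add: \<mu>_single f(3))
  qed simp
  moreover have "(\<lambda>k. \<mu> k A) \<longlonglongrightarrow> 0" for A
  proof -
    have "strict_mono j"
      using j p_mono by (intro strict_monoI_Suc) (meson less_le_trans)
    then have "(\<lambda>k. apply_bcontfun (S (R A)) (j k)) \<longlonglongrightarrow> 0"
      using LIMSEQ_subseq_LIMSEQ[of "apply_bcontfun (S (R A))" 0 j] S_c0[of "R A"]
      by (simp add: c0_def o_def)
    from tendsto_norm_zero[OF this] show ?thesis
      by (rule Lim_null_comparison[rotated]) (simp add: \<mu>_def f(2))
  qed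
  ultimately show False by blast
qed

theorem corollary4p2:
  fixes scaleX :: "'k::real_normed_field \<Rightarrow> 'a::banach \<Rightarrow> 'a"
    and scaleY :: "'k \<Rightarrow> 'b::banach \<Rightarrow> 'b"
  assumes "banach_space_over scaleX" and "banach_space_over scaleY"
    and "\<And>n::nat. n \<ge> 1 \<Longrightarrow>
      \<not> (\<exists>T. linear_embedding (linf_scale scaleX) (linf_scale scaleY)
            (c0 :: 'a linf set) (npower n :: 'b linf set) T)"
  shows "\<not> (\<exists>Z :: 'b linf set. complemented_subspace (linf_scale scaleY) Z \<and>
      linearly_homeomorphic (linf_scale scaleY) (linf_scale scaleX) Z (c0 :: 'a linf set))"
proof
  assume "\<exists>Z :: 'b linf set. complemented_subspace (linf_scale scaleY) Z \<and>
      linearly_homeomorphic (linf_scale scaleY) (linf_scale scaleX) Z (c0 :: 'a linf set)"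
  then obtain Z P and f :: "'b linf \<Rightarrow> 'a linf" and g :: "'a linf \<Rightarrow> 'b linf"
    where P: "bounded_linear_map_on (linf_scale scaleY) (linf_scale scaleY) UNIV P"
      "P \<circ> P = P" "range P = Z"
      and f: "linear_map_on (linf_scale scaleY) (linf_scale scaleX) Z f"
      and fg: "homeomorphism Z c0 f g"
    unfolding complemented_subspace_def linearly_homeomorphic_def by blast
  interpret X: banach_space_over scaleX by fact
  interpret Y: banach_space_over scaleY by fact
  note X' = X.banach_space_over_linf and Y' = Y.banach_space_over_linf
  have P_lin: "linear_map_on (linf_scale scaleY) (linf_scale scaleY) UNIV P"
    using P(1) by (simp add: bounded_linear_map_on_def)
  have P_add: "P (x + y) = P x + P y" and P_scale: "P (linf_scale scaleY c x) = linf_scale scaleY c (P x)"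
    for x y c
    using P_lin by (simp_all add: linear_map_on_def)
  have P_scaleR: "P (r *\<^sub>R x) = r *\<^sub>R P x" for r x
    by (rule linear_map_on_scaleR[OF Y' Y' P_lin]) simp
  have P_Z: "P x \<in> Z" for x
    using P(3) by blast
  have P_id: "P z = z" if "z \<in> Z" for z
    using that P(2,3) by (auto simp: o_def fun_eq_iff)
  have Z_add: "x + y \<in> Z" if "x \<in> Z" "y \<in> Z" for x y
    using that P_Z[of "x + y"] by (simp add: P_add P_id)
  have Z_scale: "linf_scale scaleY c x \<in> Z" if "x \<in> Z" for c x
    using that P_Z[of "linf_scale scaleY c x"] by (simp add: P_scale P_id)
  have Z_scaleR: "r *\<^sub>R x \<in> Z" if "x \<in> Z" for r x
    using that P_Z[of "r *\<^sub>R x"] by (simp add: P_scaleR P_id)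
  have f_add: "f (x + y) = f x + f y" if "x \<in> Z" "y \<in> Z" for x y
    using f that by (simp add: linear_map_on_def)
  have f_scale: "f (linf_scale scaleY c x) = linf_scale scaleX c (f x)" if "x \<in> Z" for x c
    using f that by (simp add: linear_map_on_def)
  have f_c0: "f z \<in> c0" if "z \<in> Z" for z
    using fg that by (auto simp: homeomorphism_def)
  have g_Z: "g v \<in> Z" if "v \<in> c0" for v
    using fg that by (auto simp: homeomorphism_def)
  have f_g: "f (g v) = v" if "v \<in> c0" for v
    using fg that by (simp add: homeomorphism_def)
  have g_f: "g (f z) = z" if "z \<in> Z" for z
    using fg that by (simp add: homeomorphism_def)
  have g_add: "g (x + y) = g x + g y" if "x \<in> c0" "y \<in> c0" for x y
    using that g_f[of "g x + g y"] by (simp add: f_add f_g g_Z Z_add)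
  have g_scale: "g (linf_scale scaleX c x) = linf_scale scaleY c (g x)" if "x \<in> c0" for c x
    using that g_f[of "linf_scale scaleY c (g x)"] by (simp add: f_scale f_g g_Z Z_scale)
  have g: "linear_map_on (linf_scale scaleX) (linf_scale scaleY) c0 g"
    by (simp add: linear_map_on_def g_add g_scale)
  have "continuous_on c0 g" "continuous_on Z f"
    using fg by (simp_all add: homeomorphism_def)
  moreover have "r *\<^sub>R v \<in> c0 \<and> g (r *\<^sub>R v) = r *\<^sub>R g v" if "v \<in> c0" for r v
    using that linear_map_on_scaleR[OF X' Y' g] c0_scaleR by blast
  moreover have "r *\<^sub>R z \<in> Z \<and> f (r *\<^sub>R z) = r *\<^sub>R f z" if "z \<in> Z" for r z
    using that linear_map_on_scaleR[OF Y' X' f] Z_scaleR by blast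
  ultimately obtain B D1 where B: "B > 0" "\<And>v. v \<in> c0 \<Longrightarrow> norm (g v) \<le> B * norm v"
    and D1: "D1 > 0" "\<And>z. z \<in> Z \<Longrightarrow> norm (f z) \<le> D1 * norm z"
    using linear_continuous_imp_bounded_on[of c0 g] linear_continuous_imp_bounded_on[of Z f] by blast
  obtain D2 where D2: "\<And>x. norm (P x) \<le> D2 * norm x"
    using P(1) by (auto simp: bounded_linear_map_on_def)
  have fP_bound: "norm (f (P y)) \<le> D1 * \<bar>D2\<bar> * norm y" for y
  proof -
    have "norm (f (P y)) \<le> D1 * norm (P y)"
      by (rule D1(2)[OF P_Z])
    also have "norm (P y) \<le> \<bar>D2\<bar> * norm y"
      using D2[of y] mult_right_mono[OF abs_ge_self[of D2], of "norm y"] by simp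
    finally show ?thesis
      using D1(1) by (simp add: mult.assoc)
  qed
  have g_bounded: "bounded_linear_map_on (linf_scale scaleX) (linf_scale scaleY) c0 g"
    using g B(2) by (auto simp: bounded_linear_map_on_def)
  show False
  proof (rule no_left_inverse_on_c0[of g B "f \<circ> P" "D1 * \<bar>D2\<bar>"])
    show "\<exists>u p j. is_hump g m n e u p j" if "e > 0" for m n and e :: real
      using assms g_bounded that by (rule hump_exists)
  qed (use B D1(1) in \<open>simp_all add: g_add P_add f_add P_Z f_c0 fP_bound P_id g_Z f_g\<close>)
qed

end
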